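(* Let $\gamma_1,\gamma_2\in L^\infty_{\mathrm{loc}}(\mathbb R)$ and define the locally Lipschitz function $\phi:\mathbb R^2\to\mathbb R$ by $$\phi(t,s)=\int_0^t\gamma_1(\xi)\,d\xi+\int_0^s\gamma_2(\xi)\,d\xi .$$ Then for every $(t,s)\in\mathbb R^2$, $$\partial\phi(t,s)\subset\widehat\gamma_1(t)\times\widehat\gamma_2(s).$$ If in addition the one-sided limits $\gamma_1(t\pm0)$ and $\gamma_2(s\pm0)$ exist for every $t,s\in\mathbb R$, then $$\partial\phi(t,s)=\widehat\gamma_1(t)\times\widehat\gamma_2(s).$$
   Context: For a locally Lipschitz function $\phi:\mathbb R^n\to\mathbb R$, $\phi^\circ(x;v)=\limsup_{w\to x,\,h\downarrow0}\frac{\phi(w+hv)-\phi(w)}{h}$ and $\partial\phi(x)=\{\xi\in\mathbb R^n:\xi\cdot v\le\phi^\circ(x;v)\ \forall v\in\mathbb R^n\}$ is the Clarke generalized gradient. For $\gamma\in L^\infty_{\mathrm{loc}}(\mathbb R)$ and $\mu>0$ put $\overline\gamma_\mu(t)=\operatorname{ess\,sup}_{|s-t|<\mu}\gamma(s)$ and $\underline\gamma_\mu(t)=\operatorname{ess\,inf}_{|s-t|<\mu}\gamma(s)$; these are monotone in $\mu$ and one sets $\overline\gamma(t)=\lim_{\mu\to0^+}\overline\gamma_\mu(t)$, $\underline\gamma(t)=\lim_{\mu\to0^+}\underline\gamma_\mu(t)$. Then $\widehat\gamma(t)=[\underline\gamma(t),\overline\gamma(t)]$. The notation $\gamma(t\pm0)$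 denotes the right and left limits of $\gamma$ at $t$. *)

theory Defs
  imports "HOL-Analysis.Analysis" "HOL-Probability.Essential_Supremum"
begin

text \<open>The base point \<open>w\<close> ranges over full neighbourhoods of \<open>x\<close> (with \<open>w = x\<close> allowed) and the
  limsup is joint in \<open>(w, h)\<close>. It is taken in \<^typ>\<open>ereal\<close>, where it always exists; for locally
  Lipschitz \<open>\<phi>\<close> it is finite.\<close>

definition clarke_deriv :: "('a::euclidean_space \<Rightarrow> real) \<Rightarrow> 'a \<Rightarrow> 'a \<Rightarrow> ereal" where
  "clarke_deriv \<phi> x v =
     Limsup (nhds x \<times>\<^sub>F at_right 0) (\<lambda>(w, h). ereal ((\<phi> (w + h *\<^sub>R v) - \<phi> w) / h))"

definition clarke_gradient :: "('a::euclidean_space \<Rightarrow> real) \<Rightarrow> 'a \<Rightarrow> 'a set" where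
  "clarke_gradient \<phi> x = {\<xi>. \<forall>v. ereal (\<xi> \<bullet> v) \<le> clarke_deriv \<phi> x v}"

definition locally_lipschitz :: "('a::euclidean_space \<Rightarrow> real) \<Rightarrow> bool" where
  "locally_lipschitz \<phi> \<longleftrightarrow> (\<forall>x. \<exists>r>0. \<exists>L. L-lipschitz_on (cball x r) \<phi>)"

definition Linf_loc :: "(real \<Rightarrow> real) set" where
  "Linf_loc = {\<gamma> \<in> borel_measurable lebesgue.
     \<forall>K. compact K \<longrightarrow> (\<exists>C. AE x in lebesgue_on K. \<bar>\<gamma> x\<bar> \<le> C)}"

text \<open>Dual of \<^const>\<open>esssup\<close>, including its convention for non-measurable functions.\<close>

definition essinf :: "'a measure \<Rightarrow> ('a \<Rightarrow> ereal) \<Rightarrow> ereal" where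
  "essinf M f = (if f \<in> borel_measurable M then Liminf (ae_filter M) f else bot)"

definition upper_reg_at :: "(real \<Rightarrow> real) \<Rightarrow> real \<Rightarrow> real \<Rightarrow> ereal" where
  "upper_reg_at \<gamma> \<mu> t = esssup (lebesgue_on {s. \<bar>s - t\<bar> < \<mu>}) (\<lambda>s. ereal (\<gamma> s))"

definition lower_reg_at :: "(real \<Rightarrow> real) \<Rightarrow> real \<Rightarrow> real \<Rightarrow> ereal" where
  "lower_reg_at \<gamma> \<mu> t = essinf (lebesgue_on {s. \<bar>s - t\<bar> < \<mu>}) (\<lambda>s. ereal (\<gamma> s))"

definition upper_reg :: "(real \<Rightarrow> real) \<Rightarrow> real \<Rightarrow> ereal" where
  "upper_reg \<gamma> t = Lim (at_right 0) (\<lambda>\<mu>. upper_reg_at \<gamma> \<mu> t)"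

definition lower_reg :: "(real \<Rightarrow> real) \<Rightarrow> real \<Rightarrow> ereal" where
  "lower_reg \<gamma> t = Lim (at_right 0) (\<lambda>\<mu>. lower_reg_at \<gamma> \<mu> t)"

definition filled :: "(real \<Rightarrow> real) \<Rightarrow> real \<Rightarrow> real set" where
  "filled \<gamma> t = {x. lower_reg \<gamma> t \<le> ereal x \<and> ereal x \<le> upper_reg \<gamma> t}"

definition has_one_sided_limits :: "(real \<Rightarrow> real) \<Rightarrow> real \<Rightarrow> bool" where
  "has_one_sided_limits \<gamma> t \<longleftrightarrow>
     (\<exists>l. (\<gamma> \<longlongrightarrow> l) (at_right t)) \<and> (\<exists>l. (\<gamma> \<longlongrightarrow> l) (at_left t))"

lemma Linf_loc_bound:
  assumes "\<gamma> \<in> Linf_loc"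
  obtains C where "C \<ge> 0" "AE x in lebesgue. x \<in> {a..b} \<longrightarrow> \<bar>\<gamma> x\<bar> \<le> C"
proof -
  obtain C where "AE x in lebesgue_on {a..b}. \<bar>\<gamma> x\<bar> \<le> C"
    using assms unfolding Linf_loc_def by blast
  then have "AE x in lebesgue. x \<in> {a..b} \<longrightarrow> \<bar>\<gamma> x\<bar> \<le> C"
    by (subst (asm) AE_restrict_space_iff) auto
  then have "AE x in lebesgue. x \<in> {a..b} \<longrightarrow> \<bar>\<gamma> x\<bar> \<le> max C 0"
    by eventually_elim auto
  then show thesis using that[of "max C 0"] by auto
qed

lemma Linf_loc_set_integrable:
  assumes "\<gamma> \<in> Linf_loc"
  shows "set_integrable lebesgue {a..b} \<gamma>"
proof -
  obtain C where C: "AE x in lebesgue. x \<in> {a..b} \<longrightarrow> \<bar>\<gamma> x\<bar> \<le> C"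
    using Linf_loc_bound[OF assms] by metis
  have [measurable]: "\<gamma> \<in> borel_measurable lebesgue"
    using assms by (simp add: Linf_loc_def)
  have "set_integrable lebesgue {a..b} (\<lambda>_. C)"
    by (simp add: set_integrable_def lmeasurable_iff_integrable[symmetric])
  then show ?thesis
    unfolding set_integrable_def
  proof (rule Bochner_Integration.integrable_bound)
    have [measurable]: "{a..b} \<in> sets lebesgue" by simp
    show "(\<lambda>x. indicat_real {a..b} x *\<^sub>R \<gamma> x) \<in> borel_measurable lebesgue"
      by (intro borel_measurable_scaleR borel_measurable_indicator) simp_all
    show "AE x in lebesgue. norm (indicat_real {a..b} x *\<^sub>R \<gamma> x) \<le> norm (indicat_real {a..b} x *\<^sub>R C)"
      using C by eventually_elim (auto simp: indicator_def)
  qed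
qed

lemma primitive_eq:
  assumes "\<gamma> \<in> Linf_loc" "t \<in> {-r..r}" "r \<ge> 0"
  shows "(LINT \<xi>=0..t|lebesgue. \<gamma> \<xi>) = integral {-r..t} \<gamma> - integral {-r..0} \<gamma>"
proof -
  have eq: "(LINT x:{a<..<b}|lebesgue. \<gamma> x) = integral {a..b} \<gamma>" for a b :: real
  proof -
    have "set_integrable lebesgue {a<..<b} \<gamma>"
      by (rule set_integrable_subset[OF Linf_loc_set_integrable[OF assms(1), of a b]]) auto
    then show ?thesis
      by (simp add: set_lebesgue_integral_eq_integral integral_open_interval_real)
  qed
  have int: "\<gamma> integrable_on {a..b}" for a b
    using set_lebesgue_integral_eq_integral(1)[OF Linf_loc_set_integrable[OF assms(1)]] .
  show ?thesis
  proof (cases "0 \<le> t")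
    case True
    have "integral {-r..0} \<gamma> + integral {0..t} \<gamma> = integral {-r..t} \<gamma>"
      by (rule Henstock_Kurzweil_Integration.integral_combine) (use assms True int in auto)
    then show ?thesis using True
      by (simp add: interval_lebesgue_integral_def eq zero_ereal_def)
  next
    case False
    have "integral {-r..t} \<gamma> + integral {t..0} \<gamma> = integral {-r..0} \<gamma>"
      by (rule Henstock_Kurzweil_Integration.integral_combine) (use assms False int in auto)
    then show ?thesis using False
      by (simp add: interval_lebesgue_integral_def eq zero_ereal_def)
  qed
qed

lemma primitive_lipschitz:
  assumes "\<gamma> \<in> Linf_loc" "r \<ge> 0"
  shows "\<exists>C. C-lipschitz_on {-r..r} (\<lambda>t. LINT \<xi>=0..t|lebesgue. \<gamma> \<xi>)"
proof -
  obtain C where C: "C \<ge> 0" "AE x in lebesgue. x \<in> {-r..r} \<longrightarrow> \<bar>\<gamma> x\<bar> \<le> C"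
    using Linf_loc_bound[OF assms(1)] by metis
  note si = Linf_loc_set_integrable[OF assms(1)]
  have int: "\<gamma> integrable_on {a..b}" for a b
    using set_lebesgue_integral_eq_integral(1)[OF si] .
  have bound: "\<bar>integral {s..t} \<gamma>\<bar> \<le> C * (t - s)" if "-r \<le> s" "s \<le> t" "t \<le> r" for s t
  proof -
    have "\<bar>integral {s..t} \<gamma>\<bar> = \<bar>LINT x:{s..t}|lebesgue. \<gamma> x\<bar>"
      using set_lebesgue_integral_eq_integral(2)[OF si] by simp
    also have "\<dots> \<le> (LINT x:{s..t}|lebesgue. \<bar>\<gamma> x\<bar>)"
      using set_integral_norm_bound[OF si] by simp
    also have "\<dots> \<le> (LINT x:{s..t}|lebesgue. C)"
      unfolding set_lebesgue_integral_def
    proof (rule integral_mono_AE)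
      show "integrable lebesgue (\<lambda>x. indicat_real {s..t} x *\<^sub>R \<bar>\<gamma> x\<bar>)"
        using set_integrable_abs[OF si] by (simp add: set_integrable_def)
      show "AE x in lebesgue. indicat_real {s..t} x *\<^sub>R \<bar>\<gamma> x\<bar> \<le> indicat_real {s..t} x *\<^sub>R C"
        using C(2) by eventually_elim (use that in \<open>auto simp: indicator_def\<close>)
    qed (simp add: lmeasurable_iff_integrable[symmetric])
    also have "\<dots> = C * (t - s)" using that by (simp add: set_lebesgue_integral_def)
    finally show ?thesis .
  qed
  have "C-lipschitz_on {-r..r} (\<lambda>t. LINT \<xi>=0..t|lebesgue. \<gamma> \<xi>)"
  proof (rule lipschitz_on_leI)
    fix s t assume st: "s \<in> {-r..r}" "t \<in> {-r..r}" "s \<le> t"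
    have "integral {-r..s} \<gamma> + integral {s..t} \<gamma> = integral {-r..t} \<gamma>"
      by (rule Henstock_Kurzweil_Integration.integral_combine) (use st int in auto)
    then show "dist (LINT \<xi>=0..s|lebesgue. \<gamma> \<xi>) (LINT \<xi>=0..t|lebesgue. \<gamma> \<xi>) \<le> C * dist s t"
      using bound[of s t] st primitive_eq[OF assms(1) st(1) assms(2)]
        primitive_eq[OF assms(1) st(2) assms(2)]
      by (simp add: dist_real_def)
  qed (rule C(1))
  then show ?thesis ..
qed

lemma locally_lipschitz_primitives:
  assumes "\<gamma>\<^sub>1 \<in> Linf_loc" "\<gamma>\<^sub>2 \<in> Linf_loc"
  shows "locally_lipschitz (\<lambda>p. (LINT \<xi>=0..ereal (fst p)|lebesgue. \<gamma>\<^sub>1 \<xi>) + (LINT \<xi>=0..ereal (snd p)|lebesgue. \<gamma>\<^sub>2 \<xi>))"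
  unfolding locally_lipschitz_def
proof
  fix x :: "real \<times> real"
  define r where "r = norm x + 1"
  have r: "r \<ge> 0" by (simp add: r_def add_nonneg_nonneg)
  have sub: "fst ` cball x 1 \<subseteq> {-r..r}" "snd ` cball x 1 \<subseteq> {-r..r}"
  proof -
    have "\<bar>fst y\<bar> \<le> r \<and> \<bar>snd y\<bar> \<le> r" if "y \<in> cball x 1" for y
    proof -
      have "norm y \<le> r"
        using that norm_triangle_ineq2[of y x] by (simp add: r_def dist_norm norm_minus_commute)
      then show ?thesis
        using norm_fst_le[of "fst y" "snd y"] norm_snd_le[of "snd y" "fst y"] by simp
    qed
    then show "fst ` cball x 1 \<subseteq> {-r..r}" "snd ` cball x 1 \<subseteq> {-r..r}"
      by (fastforce simp: abs_le_iff)+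
  qed
  have lp: "1-lipschitz_on (cball x 1) fst" "1-lipschitz_on (cball x 1) snd"
    by (rule lipschitz_onI; simp only: mult_1 dist_fst_le dist_snd_le zero_le_one)+
  obtain C D where
    CD: "C-lipschitz_on {-r..r} (\<lambda>t. LINT \<xi>=0..t|lebesgue. \<gamma>\<^sub>1 \<xi>)"
        "D-lipschitz_on {-r..r} (\<lambda>t. LINT \<xi>=0..t|lebesgue. \<gamma>\<^sub>2 \<xi>)"
    using primitive_lipschitz assms r by metis
  have "(C * 1 + D * 1)-lipschitz_on (cball x 1)
     (\<lambda>p. (LINT \<xi>=0..ereal (fst p)|lebesgue. \<gamma>\<^sub>1 \<xi>) + (LINT \<xi>=0..ereal (snd p)|lebesgue. \<gamma>\<^sub>2 \<xi>))"
    by (intro lipschitz_on_add lipschitz_on_compose2[OF lp(1)] lipschitz_on_compose2[OF lp(2)]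
        lipschitz_on_subset[OF CD(1)] lipschitz_on_subset[OF CD(2)] sub)
  then show "\<exists>r>0. \<exists>L. L-lipschitz_on (cball x r)
     (\<lambda>p. (LINT \<xi>=0..ereal (fst p)|lebesgue. \<gamma>\<^sub>1 \<xi>) + (LINT \<xi>=0..ereal (snd p)|lebesgue. \<gamma>\<^sub>2 \<xi>))"
    using zero_less_one by blast
qed

end

theory Submission
  imports Defs
begin

text \<open>
  Write \<open>F\<^sub>i\<close> for the primitive of \<open>\<gamma>\<^sub>i\<close> vanishing at \<open>0\<close>, so that
  \<open>\<phi> (t, s) = F\<^sub>1 t + F\<^sub>2 s\<close>.

  The inclusion. If \<open>\<gamma>\<^sub>1 \<le> m\<close> almost everywhere near \<open>t\<close>, then every forward difference quotient
  of \<open>F\<^sub>1\<close> with small step and base point near \<open>t\<close> is at most \<open>m\<close>. The Clarke derivative of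
  \<open>F\<^sub>1\<close> in direction \<open>1\<close> is therefore at most the upper regularization of \<open>\<gamma>\<^sub>1\<close>; in direction
  \<open>-1\<close> it is at most the upper regularization of \<open>-\<gamma>\<^sub>1\<close>, which is minus the lower
  regularization of \<open>\<gamma>\<^sub>1\<close> (\<open>clarke_deriv_le_upper_reg\<close>). Moving only one coordinate turns a
  difference quotient of \<open>\<phi>\<close> into one of \<open>F\<^sub>1\<close> or \<open>F\<^sub>2\<close>, so testing an element of
  \<open>\<partial>\<phi>(t, s)\<close> on the four directions \<open>\<plusminus>(1, 0)\<close>, \<open>\<plusminus>(0, 1)\<close> bounds its two coordinates
  by the regularizations.

  The equality. The Clarke derivative sees all base points near \<open>(t, s)\<close>, in particular those of
  the four open quadrants with corner \<open>(t, s)\<close>. In a quadrant the one-sided limits make \<open>\<phi>\<close>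
  nearly affine, with slope \<open>(\<gamma>\<^sub>1(t\<plusminus>0), \<gamma>\<^sub>2(s\<plusminus>0))\<close>, and such a slope is a Clarke subgradient
  (\<open>limiting_gradient_in_clarke_gradient\<close>). So \<open>\<partial>\<phi>(t, s)\<close> contains four corners, and by
  convexity the whole rectangle that they span. This rectangle contains the product of the filled
  graphs, because near \<open>t\<close> the function \<open>\<gamma>\<^sub>1\<close> essentially takes values close to one of its two
  one-sided limits (\<open>upper_reg_le_max\<close>).
\<close>

section \<open>Increments of primitives\<close>

definition primitive :: "(real \<Rightarrow> real) \<Rightarrow> real \<Rightarrow> real" where
  "primitive \<gamma> t = (LINT \<xi>=0..t|lebesgue. \<gamma> \<xi>)"

lemma primitive_diff:
  assumes "\<gamma> \<in> Linf_loc" "x \<le> y"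
  shows "primitive \<gamma> y - primitive \<gamma> x = (LINT s:{x..y}|lebesgue. \<gamma> s)"
proof -
  define r where "r = max \<bar>x\<bar> \<bar>y\<bar>"
  have int: "\<gamma> integrable_on {a..b}" for a b
    using set_lebesgue_integral_eq_integral(1)[OF Linf_loc_set_integrable[OF assms(1)]] .
  have r: "r \<ge> 0" "x \<in> {-r..r}" "y \<in> {-r..r}"
    by (auto simp: r_def)
  have "integral {-r..x} \<gamma> + integral {x..y} \<gamma> = integral {-r..y} \<gamma>"
    by (rule Henstock_Kurzweil_Integration.integral_combine) (use r assms int in auto)
  then show ?thesis
    using primitive_eq[OF assms(1) r(2,1)] primitive_eq[OF assms(1) r(3,1)]
      set_lebesgue_integral_eq_integral(2)[OF Linf_loc_set_integrable[OF assms(1), of x y]]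
    by (simp add: primitive_def)
qed

lemma primitive_diff_le:
  assumes "\<gamma> \<in> Linf_loc" "x \<le> y" "AE s in lebesgue. s \<in> {x..y} \<longrightarrow> \<gamma> s \<le> M"
  shows "primitive \<gamma> y - primitive \<gamma> x \<le> M * (y - x)"
proof -
  have "(LINT s:{x..y}|lebesgue. \<gamma> s) \<le> (LINT s:{x..y}|lebesgue. M)"
    by (rule set_integral_mono_AE)
       (use assms Linf_loc_set_integrable in
         \<open>auto simp: set_integrable_def lmeasurable_iff_integrable[symmetric]\<close>)
  then show ?thesis
    using assms by (simp add: primitive_diff set_lebesgue_integral_def mult.commute)
qed

lemma primitive_diff_ge:
  assumes "\<gamma> \<in> Linf_loc" "x \<le> y" "AE s in lebesgue. s \<in> {x..y} \<longrightarrow> M \<le> \<gamma> s"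
  shows "M * (y - x) \<le> primitive \<gamma> y - primitive \<gamma> x"
proof -
  have "(LINT s:{x..y}|lebesgue. M) \<le> (LINT s:{x..y}|lebesgue. \<gamma> s)"
    by (rule set_integral_mono_AE)
       (use assms Linf_loc_set_integrable in
         \<open>auto simp: set_integrable_def lmeasurable_iff_integrable[symmetric]\<close>)
  then show ?thesis
    using assms by (simp add: primitive_diff set_lebesgue_integral_def mult.commute)
qed

section \<open>Upper and lower regularizations\<close>

lemma Linf_loc_uminus: "\<gamma> \<in> Linf_loc \<Longrightarrow> (\<lambda>s. - \<gamma> s) \<in> Linf_loc"
  by (auto simp: Linf_loc_def)

lemma Linf_loc_measurable:
  assumes "\<gamma> \<in> Linf_loc"
  shows "(\<lambda>s. ereal (\<gamma> s)) \<in> borel_measurable (lebesgue_on A)"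
proof -
  have [measurable]: "\<gamma> \<in> borel_measurable (lebesgue_on A)"
    using assms by (auto simp: Linf_loc_def intro: measurable_restrict_space1)
  show ?thesis by measurable
qed

lemma AE_lebesgue_on_interval:
  "(AE s in lebesgue_on {s. \<bar>s - t\<bar> < \<mu>}. P s) \<longleftrightarrow> (AE s in lebesgue. \<bar>s - t\<bar> < \<mu> \<longrightarrow> P s)"
  for t \<mu> :: real
proof -
  have "{s. \<bar>s - t\<bar> < \<mu>} = ball t \<mu>"
    by (auto simp: dist_real_def abs_minus_commute)
  then have "{s. \<bar>s - t\<bar> < \<mu>} \<in> sets lebesgue" by simp
  then show ?thesis by (simp add: AE_restrict_space_iff)
qed

lemma upper_reg_at_le:
  assumes "\<gamma> \<in> Linf_loc" "AE s in lebesgue. \<bar>s - t\<bar> < \<mu> \<longrightarrow> ereal (\<gamma> s) \<le> c"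
  shows "upper_reg_at \<gamma> \<mu> t \<le> c"
  unfolding upper_reg_at_def
  using assms by (intro esssup_I Linf_loc_measurable) (simp_all add: AE_lebesgue_on_interval)

lemma AE_le_upper_reg_at:
  "AE s in lebesgue. \<bar>s - t\<bar> < \<mu> \<longrightarrow> ereal (\<gamma> s) \<le> upper_reg_at \<gamma> \<mu> t"
  unfolding upper_reg_at_def AE_lebesgue_on_interval[symmetric] by (rule esssup_AE)

lemma upper_reg_at_mono:
  assumes "\<gamma> \<in> Linf_loc" "\<mu> \<le> \<nu>"
  shows "upper_reg_at \<gamma> \<mu> t \<le> upper_reg_at \<gamma> \<nu> t"
proof (rule upper_reg_at_le[OF assms(1)])
  show "AE s in lebesgue. \<bar>s - t\<bar> < \<mu> \<longrightarrow> ereal (\<gamma> s) \<le> upper_reg_at \<gamma> \<nu> t"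
    using AE_le_upper_reg_at[of t \<nu> \<gamma>] by eventually_elim (use assms in auto)
qed

lemma tendsto_INF_at_right_0:
  fixes f :: "real \<Rightarrow> 'a::{complete_linorder, linorder_topology}"
  assumes "mono f"
  shows "(f \<longlongrightarrow> (INF \<mu>\<in>{0<..}. f \<mu>)) (at_right 0)"
proof (rule order_tendstoI)
  fix a assume "a < (INF \<mu>\<in>{0<..}. f \<mu>)"
  then have "a < f \<mu>" if "\<mu> > 0" for \<mu>
    using that by (auto intro: less_le_trans INF_lower)
  then show "\<forall>\<^sub>F \<mu> in at_right 0. a < f \<mu>"
    by (auto simp: eventually_at_right_field intro: exI[of _ 1])
next
  fix a assume "(INF \<mu>\<in>{0<..}. f \<mu>) < a"
  then obtain \<nu> where "\<nu> > 0" "f \<nu> < a"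
    by (auto simp: INF_less_iff)
  then have "f \<mu> < a" if "\<mu> < \<nu>" for \<mu>
    using monoD[OF assms, of \<mu> \<nu>] that by (auto intro: le_less_trans)
  then show "\<forall>\<^sub>F \<mu> in at_right 0. f \<mu> < a"
    using \<open>\<nu> > 0\<close> by (auto simp: eventually_at_right_field)
qed

lemma tendsto_upper_reg_at:
  assumes "\<gamma> \<in> Linf_loc"
  shows "((\<lambda>\<mu>. upper_reg_at \<gamma> \<mu> t) \<longlongrightarrow> (INF \<mu>\<in>{0<..}. upper_reg_at \<gamma> \<mu> t)) (at_right 0)"
  by (rule tendsto_INF_at_right_0) (auto intro!: monoI upper_reg_at_mono assms)

text \<open>The regularization is a \<^const>\<open>Lim\<close>, which says nothing until the limit is known to exist;
  it does since the essential suprema decrease as the interval shrinks.\<close>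

lemma upper_reg_eq_INF:
  assumes "\<gamma> \<in> Linf_loc"
  shows "upper_reg \<gamma> t = (INF \<mu>\<in>{0<..}. upper_reg_at \<gamma> \<mu> t)"
  unfolding upper_reg_def by (rule tendsto_Lim[OF _ tendsto_upper_reg_at[OF assms]]) simp

lemma lower_reg_at_eq: "lower_reg_at \<gamma> \<mu> t = - upper_reg_at (\<lambda>s. - \<gamma> s) \<mu> t"
proof -
  define M where "M = lebesgue_on {s. \<bar>s - t\<bar> < \<mu>}"
  have "(\<lambda>s. ereal (- \<gamma> s)) \<in> borel_measurable M \<longleftrightarrow> (\<lambda>s. ereal (\<gamma> s)) \<in> borel_measurable M"
    using borel_measurable_uminus_eq[of \<gamma> M] by (simp only: borel_measurable_ereal_iff)
  then show ?thesis
    unfolding lower_reg_at_def upper_reg_at_def essinf_def esssup_def M_def[symmetric]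
    using ereal_Limsup_uminus[of "ae_filter M" "\<lambda>s. ereal (\<gamma> s)"]
    by (auto simp: top_ereal_def bot_ereal_def)
qed

text \<open>This duality reduces every statement on lower regularizations to upper ones.\<close>

lemma lower_reg_eq:
  assumes "\<gamma> \<in> Linf_loc"
  shows "lower_reg \<gamma> t = - upper_reg (\<lambda>s. - \<gamma> s) t"
  unfolding lower_reg_def lower_reg_at_eq upper_reg_eq_INF[OF Linf_loc_uminus[OF assms]]
  by (rule tendsto_Lim)
     (auto intro!: tendsto_uminus_ereal tendsto_upper_reg_at Linf_loc_uminus assms)

lemma mem_filled_iff:
  assumes "\<gamma> \<in> Linf_loc"
  shows "a \<in> filled \<gamma> t \<longleftrightarrow> ereal a \<le> upper_reg \<gamma> t \<and> ereal (- a) \<le> upper_reg (\<lambda>s. - \<gamma> s) t"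
  unfolding filled_def lower_reg_eq[OF assms]
  using ereal_uminus_le_reorder[of "upper_reg (\<lambda>s. - \<gamma> s) t" "ereal a"] by auto

lemma upper_reg_lessD:
  assumes "\<gamma> \<in> Linf_loc" "upper_reg \<gamma> t < ereal m"
  obtains \<mu> where "\<mu> > 0" "AE s in lebesgue. \<bar>s - t\<bar> < \<mu> \<longrightarrow> \<gamma> s \<le> m"
proof -
  obtain \<mu> where \<mu>: "\<mu> > 0" "upper_reg_at \<gamma> \<mu> t < ereal m"
    using assms by (auto simp: upper_reg_eq_INF INF_less_iff)
  have "AE s in lebesgue. \<bar>s - t\<bar> < \<mu> \<longrightarrow> \<gamma> s \<le> m"
    using AE_le_upper_reg_at[of t \<mu> \<gamma>]
    by eventually_elim (use \<mu>(2) in \<open>auto dest: le_less_trans\<close>)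
  with \<mu>(1) show ?thesis by (rule that)
qed

section \<open>The Clarke gradient lies in the filled graphs\<close>

text \<open>Over a step of length \<open>h\<close> in direction \<open>\<sigma> = \<plusminus>1\<close> the primitive grows by the integral of
  \<open>\<sigma>\<gamma>\<close> over the segment traversed, hence by at most \<open>m h\<close> as soon as \<open>\<sigma>\<gamma> \<le> m\<close> almost
  everywhere there.\<close>

lemma clarke_deriv_le_upper_reg:
  assumes "\<gamma> \<in> Linf_loc" "\<bar>\<sigma>\<bar> = 1"
  shows "clarke_deriv (primitive \<gamma>) t \<sigma> \<le> upper_reg (\<lambda>s. \<sigma> * \<gamma> s) t"
proof (rule dense_ge)
  have "\<sigma> = 1 \<or> \<sigma> = - 1" using assms(2) by auto
  then have \<sigma>\<gamma>: "(\<lambda>s. \<sigma> * \<gamma> s) \<in> Linf_loc"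
    using assms(1) Linf_loc_uminus[OF assms(1)] by auto
  fix z assume "upper_reg (\<lambda>s. \<sigma> * \<gamma> s) t < z"
  then obtain m where m: "upper_reg (\<lambda>s. \<sigma> * \<gamma> s) t < ereal m" "ereal m < z"
    using ereal_dense2 by blast
  obtain \<mu> where \<mu>: "\<mu> > 0" "AE s in lebesgue. \<bar>s - t\<bar> < \<mu> \<longrightarrow> \<sigma> * \<gamma> s \<le> m"
    using upper_reg_lessD[OF \<sigma>\<gamma> m(1)] .
  \<comment> \<open>Base point within \<open>\<mu> / 2\<close> of \<open>t\<close> and step below \<open>\<mu> / 2\<close> keep the segment inside the
    interval on which the bound \<open>m\<close> holds.\<close>
  have quot: "(primitive \<gamma> (w + h *\<^sub>R \<sigma>) - primitive \<gamma> w) / h \<le> m"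
    if w: "t - \<mu> / 2 < w" "w < t + \<mu> / 2" and h: "0 < h" "h < \<mu> / 2" for w h
  proof (cases "\<sigma> = 1")
    case True
    have "AE s in lebesgue. s \<in> {w..w + h} \<longrightarrow> \<gamma> s \<le> m"
      using \<mu>(2) by eventually_elim (use True w h in \<open>auto simp: abs_less_iff\<close>)
    with primitive_diff_le[OF assms(1), of w "w + h" m] True h show ?thesis
      by (simp add: divide_le_eq)
  next
    case False
    with assms(2) have \<sigma>: "\<sigma> = -1" by auto
    have "AE s in lebesgue. s \<in> {w - h..w} \<longrightarrow> - m \<le> \<gamma> s"
      using \<mu>(2) by eventually_elim (use \<sigma> w h in \<open>auto simp: abs_less_iff\<close>)
    with primitive_diff_ge[OF assms(1), of "w - h" w "- m"] \<sigma> h show ?thesis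
      by (simp add: divide_le_eq)
  qed
  have "\<forall>\<^sub>F w in nhds t. t - \<mu> / 2 < w \<and> w < t + \<mu> / 2"
    using \<mu>(1) by (intro eventually_conj order_tendstoD(1)[OF filterlim_ident] order_tendstoD(2)[OF filterlim_ident]) auto
  moreover have "\<forall>\<^sub>F h in at_right 0. 0 < h \<and> h < \<mu> / 2"
    using \<mu>(1) by (auto simp: eventually_at_right_field intro!: exI[of _ "\<mu> / 2"])
  ultimately have "\<forall>\<^sub>F (w, h) in nhds t \<times>\<^sub>F at_right 0.
      ereal ((primitive \<gamma> (w + h *\<^sub>R \<sigma>) - primitive \<gamma> w) / h) \<le> ereal m"
    unfolding eventually_prod_filter using quot by fastforce
  then have "clarke_deriv (primitive \<gamma>) t \<sigma> \<le> ereal m"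
    unfolding clarke_deriv_def by (intro Limsup_bounded) (simp add: case_prod_unfold)
  with m(2) show "clarke_deriv (primitive \<gamma>) t \<sigma> \<le> z" by simp
qed

lemma Limsup_subset_filter:
  fixes f :: "'a \<Rightarrow> 'b::complete_linorder"
  assumes "F \<le> G"
  shows "Limsup F f \<le> Limsup G f"
  unfolding Limsup_def using assms by (intro INF_superset_mono) (auto simp: le_filter_def)

text \<open>When the increments of \<open>\<phi>\<close> along \<open>v\<close> are those of \<open>f\<close> along \<open>u\<close> at the image points under
  \<open>P\<close>, the limsup on the left runs over fewer base points, namely those of the form \<open>P w\<close>. With a
  coordinate projection as \<open>P\<close> this reduces partial directions in the plane to the line.\<close>

lemma clarke_deriv_factor_le:
  fixes \<phi> :: "'a::euclidean_space \<Rightarrow> real" and f :: "'b::euclidean_space \<Rightarrow> real"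
  assumes "isCont P x"
    and "\<And>w h. \<phi> (w + h *\<^sub>R v) - \<phi> w = f (P w + h *\<^sub>R u) - f (P w)"
  shows "clarke_deriv \<phi> x v \<le> clarke_deriv f (P x) u"
proof -
  let ?T = "\<lambda>(w, h::real). (P w, h)"
  let ?q = "\<lambda>(w, h). ereal ((f (w + h *\<^sub>R u) - f w) / h)"
  have "filterlim P (nhds (P x)) (nhds x)"
    using assms(1) by (simp add: isCont_def tendsto_at_iff_tendsto_nhds)
  then have "filterlim ?T (nhds (P x) \<times>\<^sub>F at_right 0) (nhds x \<times>\<^sub>F at_right 0)"
    unfolding case_prod_unfold
    by (intro filterlim_Pair filterlim_compose[OF _ filterlim_fst] filterlim_snd)
  then have "Limsup (filtermap ?T (nhds x \<times>\<^sub>F at_right 0)) ?q \<le> clarke_deriv f (P x) u"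
    unfolding clarke_deriv_def by (intro Limsup_subset_filter) (simp add: filterlim_def)
  moreover have "clarke_deriv \<phi> x v = Limsup (nhds x \<times>\<^sub>F at_right 0) (\<lambda>p. ?q (?T p))"
    unfolding clarke_deriv_def by (simp add: assms(2) case_prod_unfold)
  ultimately show ?thesis
    by (simp only:) (rule order_trans[OF Limsup_filtermap_ge])
qed

lemma mem_filledI_clarke_deriv:
  assumes "\<gamma> \<in> Linf_loc"
    and "ereal a \<le> clarke_deriv (primitive \<gamma>) t 1"
    and "ereal (- a) \<le> clarke_deriv (primitive \<gamma>) t (- 1)"
  shows "a \<in> filled \<gamma> t"
proof -
  have "clarke_deriv (primitive \<gamma>) t 1 \<le> upper_reg \<gamma> t"
    using clarke_deriv_le_upper_reg[OF assms(1), of 1 t] by simp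
  moreover have "clarke_deriv (primitive \<gamma>) t (- 1) \<le> upper_reg (\<lambda>s. - \<gamma> s) t"
    using clarke_deriv_le_upper_reg[OF assms(1), of "- 1" t] by simp
  ultimately show ?thesis
    using assms(2,3) unfolding mem_filled_iff[OF assms(1)] by (blast intro: order_trans)
qed

lemma clarke_gradient_subset_filled:
  fixes \<gamma>\<^sub>1 \<gamma>\<^sub>2 :: "real \<Rightarrow> real"
  assumes "\<gamma>\<^sub>1 \<in> Linf_loc" "\<gamma>\<^sub>2 \<in> Linf_loc"
    and \<phi>: "\<And>t s. \<phi> (t, s) = primitive \<gamma>\<^sub>1 t + primitive \<gamma>\<^sub>2 s"
  shows "clarke_gradient \<phi> (t, s) \<subseteq> filled \<gamma>\<^sub>1 t \<times> filled \<gamma>\<^sub>2 s"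
proof
  fix \<xi> assume \<xi>: "\<xi> \<in> clarke_gradient \<phi> (t, s)"
  obtain a b where ab: "\<xi> = (a, b)" by (cases \<xi>)
  have le: "ereal (a * v + b * w) \<le> clarke_deriv \<phi> (t, s) (v, w)" for v w
    using \<xi> by (auto simp: ab clarke_gradient_def)
  have "clarke_deriv \<phi> (t, s) (v, 0) \<le> clarke_deriv (primitive \<gamma>\<^sub>1) (fst (t, s)) v" for v
    by (rule clarke_deriv_factor_le) (auto simp: \<phi> split_paired_all)
  then have a: "ereal (a * v) \<le> clarke_deriv (primitive \<gamma>\<^sub>1) t v" for v
    using order_trans[OF le[of v 0]] by simp
  have "clarke_deriv \<phi> (t, s) (0, v) \<le> clarke_deriv (primitive \<gamma>\<^sub>2) (snd (t, s)) v" for v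
    by (rule clarke_deriv_factor_le) (auto simp: \<phi> split_paired_all)
  then have b: "ereal (b * v) \<le> clarke_deriv (primitive \<gamma>\<^sub>2) s v" for v
    using order_trans[OF le[of 0 v]] by simp
  have "a \<in> filled \<gamma>\<^sub>1 t"
    using a[of 1] a[of "- 1"] by (intro mem_filledI_clarke_deriv assms(1)) simp_all
  moreover have "b \<in> filled \<gamma>\<^sub>2 s"
    using b[of 1] b[of "- 1"] by (intro mem_filledI_clarke_deriv assms(2)) simp_all
  ultimately show "\<xi> \<in> filled \<gamma>\<^sub>1 t \<times> filled \<gamma>\<^sub>2 s" by (simp add: ab)
qed

section \<open>Slopes on open sets accumulating at a point\<close>

text \<open>The open set \<open>U\<close> need not contain \<open>x\<close>: the condition records a slope that \<open>\<phi>\<close> has, up to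
  an arbitrarily small relative error, on some open sets arbitrarily close to \<open>x\<close>. For
  example, both \<open>1\<close> and \<open>-1\<close> are such slopes of the absolute value at \<open>0\<close>.\<close>

definition limiting_gradient :: "('a::euclidean_space \<Rightarrow> real) \<Rightarrow> 'a \<Rightarrow> 'a \<Rightarrow> bool" where
  "limiting_gradient \<phi> x \<zeta> \<longleftrightarrow> (\<forall>\<epsilon>>0. \<forall>d>0. \<exists>U. open U \<and> U \<noteq> {} \<and> U \<subseteq> ball x d \<and>
     (\<forall>a\<in>U. \<forall>b\<in>U. \<bar>\<phi> b - \<phi> a - \<zeta> \<bullet> (b - a)\<bar> \<le> \<epsilon> * norm (b - a)))"

text \<open>The limsup in the Clarke derivative runs over moving base points, so it may be tested at a
  point \<open>a\<close> of such a set \<open>U\<close>; by openness of \<open>U\<close>, the point \<open>a + h v\<close> stays in \<open>U\<close> for small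
  \<open>h\<close>, and the quotient is then within \<open>\<epsilon> |v|\<close> of \<open>\<zeta> \<bullet> v\<close>.\<close>

lemma limiting_gradient_in_clarke_gradient:
  assumes "limiting_gradient \<phi> x \<zeta>"
  shows "\<zeta> \<in> clarke_gradient \<phi> x"
proof -
  have "ereal (\<zeta> \<bullet> v) \<le> clarke_deriv \<phi> x v" for v
  proof (rule ccontr)
    assume "\<not> ereal (\<zeta> \<bullet> v) \<le> clarke_deriv \<phi> x v"
    then obtain c where c: "clarke_deriv \<phi> x v < ereal c" "ereal c < ereal (\<zeta> \<bullet> v)"
      using ereal_dense2 by (meson not_le)
    \<comment> \<open>The gap between \<open>c\<close> and \<open>\<zeta> \<bullet> v\<close> has to exceed the error \<open>\<epsilon> |v|\<close>; the \<open>+ 1\<close> covers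
      \<open>v = 0\<close> and makes the comparison strict.\<close>
    define \<epsilon> where "\<epsilon> = (\<zeta> \<bullet> v - c) / (norm v + 1)"
    have pos: "norm v + 1 > 0" using norm_ge_zero[of v] by linarith
    have \<epsilon>: "\<epsilon> > 0" using c(2) pos by (simp add: \<epsilon>_def)
    have "\<epsilon> * (norm v + 1) = \<zeta> \<bullet> v - c" using pos by (simp add: \<epsilon>_def)
    with \<epsilon> have \<epsilon>v: "\<zeta> \<bullet> v - \<epsilon> * norm v > c" by (simp add: algebra_simps)
    have "\<forall>\<^sub>F p in nhds x \<times>\<^sub>F at_right 0.
        (case p of (w, h) \<Rightarrow> ereal ((\<phi> (w + h *\<^sub>R v) - \<phi> w) / h)) < ereal c"
      using c(1) unfolding clarke_deriv_def by (rule Limsup_lessD)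
    then obtain Q R where Q: "eventually Q (nhds x)" and R: "eventually R (at_right 0)"
      and QR: "\<And>w h. Q w \<Longrightarrow> R h \<Longrightarrow> (\<phi> (w + h *\<^sub>R v) - \<phi> w) / h < c"
      unfolding eventually_prod_filter by auto
    obtain d where d: "d > 0" "\<And>w. dist w x < d \<Longrightarrow> Q w"
      using Q by (auto simp: eventually_nhds_metric)
    obtain U a where U: "open U" "a \<in> U" "U \<subseteq> ball x d"
      and slope: "\<And>a b. a \<in> U \<Longrightarrow> b \<in> U \<Longrightarrow> \<bar>\<phi> b - \<phi> a - \<zeta> \<bullet> (b - a)\<bar> \<le> \<epsilon> * norm (b - a)"
      using assms \<epsilon> d(1) unfolding limiting_gradient_def by (metis ex_in_conv)
    have "((\<lambda>h. a + h *\<^sub>R v) \<longlongrightarrow> a + 0 *\<^sub>R v) (at_right 0)"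
      by (intro tendsto_intros)
    then have "\<forall>\<^sub>F h in at_right 0. a + h *\<^sub>R v \<in> U"
      using U(1,2) by (auto dest: topological_tendstoD)
    moreover have "\<forall>\<^sub>F h in at_right 0. (h::real) > 0"
      by (simp add: eventually_at_right_less)
    ultimately have "\<forall>\<^sub>F h in at_right 0. R h \<and> a + h *\<^sub>R v \<in> U \<and> h > 0"
      using R by eventually_elim simp
    then obtain h where h: "R h" "a + h *\<^sub>R v \<in> U" "h > 0"
      using eventually_happens' trivial_limit_at_right_real by blast
    have "Q a" using U d(2) by (auto simp: dist_commute)
    then have "\<phi> (a + h *\<^sub>R v) - \<phi> a < h * c"
      using QR[OF _ h(1)] h(3) by (simp add: divide_less_eq mult.commute)
    moreover have "h * (\<zeta> \<bullet> v) - \<epsilon> * (h * norm v) \<le> \<phi> (a + h *\<^sub>R v) - \<phi> a"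
      using slope[OF U(2) h(2)] h(3) by (simp add: abs_le_iff)
    ultimately have "h * (\<zeta> \<bullet> v - \<epsilon> * norm v) < h * c"
      by (simp add: algebra_simps)
    with \<epsilon>v h(3) show False by simp
  qed
  then show ?thesis by (simp add: clarke_gradient_def)
qed

lemma convex_clarke_gradient: "convex (clarke_gradient \<phi> x)"
proof -
  have "convex {\<xi>. ereal (\<xi> \<bullet> v) \<le> c}" for v :: 'a and c
    by (cases c) (simp_all add: inner_commute[of _ v] convex_halfspace_le)
  moreover have "clarke_gradient \<phi> x = (\<Inter>v. {\<xi>. ereal (\<xi> \<bullet> v) \<le> clarke_deriv \<phi> x v})"
    by (auto simp: clarke_gradient_def)
  ultimately show ?thesis by (simp add: convex_INT)
qed

text \<open>Slopes of the summands combine freely: the product of the two open sets serves for the sum,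
  whichever sides they are taken from. This is what yields all four corners of the rectangle.\<close>

lemma limiting_gradient_sum:
  fixes f :: "'a::euclidean_space \<Rightarrow> real" and g :: "'b::euclidean_space \<Rightarrow> real"
  assumes "limiting_gradient f t p" "limiting_gradient g s q"
    and \<phi>: "\<And>t s. \<phi> (t, s) = f t + g s"
  shows "limiting_gradient \<phi> (t, s) (p, q)"
  unfolding limiting_gradient_def
proof (intro allI impI)
  fix \<epsilon> d :: real assume pos: "\<epsilon> > 0" "d > 0"
  then have pos2: "\<epsilon> / 2 > 0" "d / 2 > 0" by auto
  obtain U where U: "open U" "U \<noteq> {}" "U \<subseteq> ball t (d / 2)"
    "\<forall>a\<in>U. \<forall>b\<in>U. \<bar>f b - f a - p \<bullet> (b - a)\<bar> \<le> \<epsilon> / 2 * norm (b - a)"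
    using assms(1) pos2 unfolding limiting_gradient_def by meson
  obtain V where V: "open V" "V \<noteq> {}" "V \<subseteq> ball s (d / 2)"
    "\<forall>a\<in>V. \<forall>b\<in>V. \<bar>g b - g a - q \<bullet> (b - a)\<bar> \<le> \<epsilon> / 2 * norm (b - a)"
    using assms(2) pos2 unfolding limiting_gradient_def by meson
  have "(a, b) \<in> ball (t, s) d" if "a \<in> U" "b \<in> V" for a b
  proof -
    have "dist (t, s) (a, b) \<le> dist t a + dist s b"
      by (simp add: dist_Pair_Pair sqrt_sum_squares_le_sum)
    also have "\<dots> < d" using that U(3) V(3) by (force simp: subset_iff)
    finally show ?thesis by simp
  qed
  then have sub: "U \<times> V \<subseteq> ball (t, s) d" by auto
  have "\<bar>\<phi> (b, b') - \<phi> (a, a') - (p, q) \<bullet> ((b, b') - (a, a'))\<bar> \<le> \<epsilon> * norm ((b, b') - (a, a'))"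
    if "a \<in> U" "b \<in> U" "a' \<in> V" "b' \<in> V" for a b a' b'
  proof -
    have "\<bar>f b - f a - p \<bullet> (b - a)\<bar> \<le> \<epsilon> / 2 * norm (b - a)"
      "\<bar>g b' - g a' - q \<bullet> (b' - a')\<bar> \<le> \<epsilon> / 2 * norm (b' - a')"
      using U(4) V(4) that by blast+
    moreover have "\<epsilon> / 2 * norm (b - a) \<le> \<epsilon> / 2 * norm (b - a, b' - a')"
      "\<epsilon> / 2 * norm (b' - a') \<le> \<epsilon> / 2 * norm (b - a, b' - a')"
      using pos norm_fst_le[of "b - a" "b' - a'"] norm_snd_le[of "b' - a'" "b - a"]
      by (auto intro!: mult_left_mono)
    ultimately have "\<bar>f b - f a - p \<bullet> (b - a)\<bar> + \<bar>g b' - g a' - q \<bullet> (b' - a')\<bar>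
        \<le> \<epsilon> * norm ((b, b') - (a, a'))"
      by simp
    moreover have "\<phi> (b, b') - \<phi> (a, a') - (p, q) \<bullet> ((b, b') - (a, a')) =
        (f b - f a - p \<bullet> (b - a)) + (g b' - g a' - q \<bullet> (b' - a'))"
      by (simp add: \<phi>)
    ultimately show ?thesis
      by (metis abs_triangle_ineq order_trans)
  qed
  then show "\<exists>W. open W \<and> W \<noteq> {} \<and> W \<subseteq> ball (t, s) d \<and>
     (\<forall>a\<in>W. \<forall>b\<in>W. \<bar>\<phi> b - \<phi> a - (p, q) \<bullet> (b - a)\<bar> \<le> \<epsilon> * norm (b - a))"
    using U(1,2) V(1,2) sub by (intro exI[of _ "U \<times> V"]) (auto simp: open_Times)
qed

section \<open>One-sided limits and equality\<close>

text \<open>Here \<open>S\<close> stands for either open half-line ending at \<open>t\<close>, so that both one-sided limits are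
  treated at once; convexity keeps the integration interval between two points of \<open>S\<close> inside \<open>S\<close>,
  where \<open>\<gamma>\<close> is within \<open>\<epsilon>\<close> of \<open>p\<close>.\<close>

lemma limiting_gradient_primitive:
  assumes "\<gamma> \<in> Linf_loc" "(\<gamma> \<longlongrightarrow> p) (at t within S)"
    and S: "open S" "convex S" "at t within S \<noteq> bot" "t \<notin> S"
  shows "limiting_gradient (primitive \<gamma>) t p"
  unfolding limiting_gradient_def
proof (intro allI impI)
  fix \<epsilon> d :: real assume pos: "\<epsilon> > 0" "d > 0"
  obtain e where "e > 0" "\<forall>s\<in>S. s \<noteq> t \<and> dist s t < e \<longrightarrow> dist (\<gamma> s) p < \<epsilon>"
    using tendstoD[OF assms(2) pos(1)] unfolding eventually_at by blast
  with S(4) have e: "e > 0" "\<And>s. s \<in> S \<Longrightarrow> dist s t < e \<Longrightarrow> \<bar>\<gamma> s - p\<bar> < \<epsilon>"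
    unfolding dist_real_def by metis+
  define U where "U = S \<inter> ball t (min d e)"
  have "t \<in> closure S"
    using S(3,4) by (metis Diff_empty Diff_insert0 not_trivial_limit_within)
  then have "U \<noteq> {}"
    using pos e(1) by (auto simp: U_def closure_approachable dist_commute disjoint_iff
        dest!: spec[of _ "min d e"])
  moreover have "open U" "U \<subseteq> ball t d"
    using S(1) by (auto simp: U_def)
  moreover have "convex U"
    unfolding U_def by (intro convex_Int S(2) convex_ball)
  have step: "\<bar>primitive \<gamma> b - primitive \<gamma> a - p * (b - a)\<bar> \<le> \<epsilon> * (b - a)"
    if "a \<in> U" "b \<in> U" "a \<le> b" for a b
  proof -
    have "{a..b} \<subseteq> U"
      using \<open>convex U\<close> that by (metis closed_segment_eq_real_ivl closed_segment_subset)
    then have near: "p - \<epsilon> \<le> \<gamma> s \<and> \<gamma> s \<le> p + \<epsilon>" if "s \<in> {a..b}" for s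
      using that e(2)[of s] by (force simp: U_def dist_commute abs_less_iff)
    show ?thesis
      using primitive_diff_le[OF assms(1) that(3), of "p + \<epsilon>"]
        primitive_diff_ge[OF assms(1) that(3), of "p - \<epsilon>"] near
      by (simp add: abs_le_iff algebra_simps)
  qed
  have "\<bar>primitive \<gamma> b - primitive \<gamma> a - p \<bullet> (b - a)\<bar> \<le> \<epsilon> * norm (b - a)"
    if "a \<in> U" "b \<in> U" for a b
    using step[of a b] step[of b a] that
    by (cases "a \<le> b") (auto simp: abs_le_iff algebra_simps)
  ultimately show "\<exists>U. open U \<and> U \<noteq> {} \<and> U \<subseteq> ball t d \<and>
     (\<forall>a\<in>U. \<forall>b\<in>U. \<bar>primitive \<gamma> b - primitive \<gamma> a - p \<bullet> (b - a)\<bar> \<le> \<epsilon> * norm (b - a))"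
    by blast
qed

text \<open>For \<open>m > max p q\<close> the one-sided limits give \<open>\<gamma> < m\<close> on a punctured neighbourhood of \<open>t\<close>,
  and the value at the single point \<open>t\<close> does not affect an essential supremum.\<close>

lemma upper_reg_le_max:
  assumes "\<gamma> \<in> Linf_loc" "(\<gamma> \<longlongrightarrow> p) (at_right t)" "(\<gamma> \<longlongrightarrow> q) (at_left t)"
  shows "upper_reg \<gamma> t \<le> ereal (max p q)"
proof (rule dense_ge)
  fix z assume "ereal (max p q) < z"
  then obtain m where m: "max p q < m" "ereal m < z"
    using ereal_dense2[of "ereal (max p q)" z] by auto
  have "\<forall>\<^sub>F s in at_right t. \<gamma> s < m" "\<forall>\<^sub>F s in at_left t. \<gamma> s < m"
    using order_tendstoD(2)[OF assms(2)] order_tendstoD(2)[OF assms(3)] m(1) by auto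
  then have "\<forall>\<^sub>F s in at t. \<gamma> s < m"
    by (simp add: eventually_at_split)
  then obtain \<mu> where \<mu>: "\<mu> > 0" "\<And>s. s \<noteq> t \<Longrightarrow> \<bar>s - t\<bar> < \<mu> \<Longrightarrow> \<gamma> s < m"
    by (auto simp: eventually_at dist_real_def)
  have "AE s in lebesgue. s \<noteq> t"
    by (rule AE_I'[of "{t}"]) auto
  then have "AE s in lebesgue. \<bar>s - t\<bar> < \<mu> \<longrightarrow> ereal (\<gamma> s) \<le> ereal m"
    by eventually_elim (use \<mu>(2) in \<open>auto intro: less_imp_le\<close>)
  then have "upper_reg_at \<gamma> \<mu> t \<le> ereal m"
    by (rule upper_reg_at_le[OF assms(1)])
  moreover have "upper_reg \<gamma> t \<le> upper_reg_at \<gamma> \<mu> t"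
    using \<mu>(1) by (auto simp: upper_reg_eq_INF[OF assms(1)] intro: INF_lower)
  ultimately show "upper_reg \<gamma> t \<le> z" using m(2) by (meson order_trans less_imp_le)
qed

lemma filled_subset_closed_segment:
  assumes "\<gamma> \<in> Linf_loc" "(\<gamma> \<longlongrightarrow> p) (at_right t)" "(\<gamma> \<longlongrightarrow> q) (at_left t)"
  shows "filled \<gamma> t \<subseteq> closed_segment p q"
proof
  fix a assume "a \<in> filled \<gamma> t"
  then have "ereal a \<le> upper_reg \<gamma> t" "ereal (- a) \<le> upper_reg (\<lambda>s. - \<gamma> s) t"
    using mem_filled_iff[OF assms(1)] by auto
  then have "ereal a \<le> ereal (max p q)" "ereal (- a) \<le> ereal (max (- p) (- q))"
    using upper_reg_le_max[OF assms]
      upper_reg_le_max[OF Linf_loc_uminus[OF assms(1)] tendsto_minus[OF assms(2)] tendsto_minus[OF assms(3)]]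
    by (blast intro: order_trans)+
  then show "a \<in> closed_segment p q"
    by (auto simp: closed_segment_eq_real_ivl max_def split: if_splits)
qed

lemma Times_closed_segment_subset_convex:
  assumes "convex C" "(a, c) \<in> C" "(a, d) \<in> C" "(b, c) \<in> C" "(b, d) \<in> C"
  shows "closed_segment a b \<times> closed_segment c d \<subseteq> C"
proof -
  have eq: "closed_segment a b \<times> closed_segment c d = convex hull ({a, b} \<times> {c, d})"
    unfolding convex_hull_Times segment_convex_hull ..
  show ?thesis
    unfolding eq by (rule hull_minimal) (use assms in auto)
qed

lemma filled_subset_clarke_gradient:
  fixes \<gamma>\<^sub>1 \<gamma>\<^sub>2 :: "real \<Rightarrow> real"
  assumes "\<gamma>\<^sub>1 \<in> Linf_loc" "\<gamma>\<^sub>2 \<in> Linf_loc"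
    and \<phi>: "\<And>t s. \<phi> (t, s) = primitive \<gamma>\<^sub>1 t + primitive \<gamma>\<^sub>2 s"
    and "has_one_sided_limits \<gamma>\<^sub>1 t" "has_one_sided_limits \<gamma>\<^sub>2 s"
  shows "filled \<gamma>\<^sub>1 t \<times> filled \<gamma>\<^sub>2 s \<subseteq> clarke_gradient \<phi> (t, s)"
proof -
  obtain p\<^sub>1 q\<^sub>1 where lim1: "(\<gamma>\<^sub>1 \<longlongrightarrow> p\<^sub>1) (at_right t)" "(\<gamma>\<^sub>1 \<longlongrightarrow> q\<^sub>1) (at_left t)"
    using assms(4) by (auto simp: has_one_sided_limits_def)
  obtain p\<^sub>2 q\<^sub>2 where lim2: "(\<gamma>\<^sub>2 \<longlongrightarrow> p\<^sub>2) (at_right s)" "(\<gamma>\<^sub>2 \<longlongrightarrow> q\<^sub>2) (at_left s)"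
    using assms(5) by (auto simp: has_one_sided_limits_def)
  have "limiting_gradient (primitive \<gamma>\<^sub>1) t p\<^sub>1" "limiting_gradient (primitive \<gamma>\<^sub>1) t q\<^sub>1"
    "limiting_gradient (primitive \<gamma>\<^sub>2) s p\<^sub>2" "limiting_gradient (primitive \<gamma>\<^sub>2) s q\<^sub>2"
    using lim1 lim2 assms(1,2) by (auto intro: limiting_gradient_primitive)
  then have "closed_segment p\<^sub>1 q\<^sub>1 \<times> closed_segment p\<^sub>2 q\<^sub>2 \<subseteq> clarke_gradient \<phi> (t, s)"
    by (intro Times_closed_segment_subset_convex convex_clarke_gradient
        limiting_gradient_in_clarke_gradient limiting_gradient_sum[where f="primitive \<gamma>\<^sub>1" and g="primitive \<gamma>\<^sub>2"] \<phi>)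
  then show ?thesis
    using filled_subset_closed_segment[OF assms(1) lim1]
      filled_subset_closed_segment[OF assms(2) lim2] by blast
qed

theorem theorem3:
  fixes \<gamma>\<^sub>1 \<gamma>\<^sub>2 :: "real \<Rightarrow> real" and \<phi> :: "real \<times> real \<Rightarrow> real"
  assumes "\<gamma>\<^sub>1 \<in> Linf_loc" and "\<gamma>\<^sub>2 \<in> Linf_loc"
    and "\<And>t s. \<phi> (t, s) = (LINT \<xi>=0..t|lebesgue. \<gamma>\<^sub>1 \<xi>) + (LINT \<xi>=0..s|lebesgue. \<gamma>\<^sub>2 \<xi>)"
  shows "(\<forall>t s. clarke_gradient \<phi> (t, s) \<subseteq> filled \<gamma>\<^sub>1 t \<times> filled \<gamma>\<^sub>2 s) \<and>
    ((\<forall>t s. has_one_sided_limits \<gamma>\<^sub>1 t \<and> has_one_sided_limits \<gamma>\<^sub>2 s) \<longrightarrow>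
      (\<forall>t s. clarke_gradient \<phi> (t, s) = filled \<gamma>\<^sub>1 t \<times> filled \<gamma>\<^sub>2 s))"
proof -
  have \<phi>: "\<phi> (t, s) = primitive \<gamma>\<^sub>1 t + primitive \<gamma>\<^sub>2 s" for t s
    by (simp add: assms(3) primitive_def)
  show ?thesis
    using clarke_gradient_subset_filled[OF assms(1,2) \<phi>]
      filled_subset_clarke_gradient[OF assms(1,2) \<phi>] by blast
qed

end
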